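(* Let $\mathbf D$ and $\mathbf M$ be fully contextual double Boolean algebras. Then $\mathbf D$ is isomorphic to $\mathbf M$ if and only if $\mathbf D_p$ is isomorphic to $\mathbf M_p$. Moreover, every dBa isomorphism from $\mathbf D_p$ to $\mathbf M_p$ extends uniquely to a dBa isomorphism from $\mathbf D$ to $\mathbf M$.
   Context: A double Boolean algebra (dBa) is an algebra $\mathbf{D}=(D,\sqcup,\sqcap,\neg,\lrcorner,\top,\bot)$ of type $(2,2,1,1,0,0)$ such that, with $x\vee y:=\neg(\neg x\sqcap\neg y)$ and $x\wedge y:=\lrcorner(\lrcorner x\sqcup\lrcorner y)$, for all $x,y,z\in D$: $(x\sqcap x)\sqcap y=x\sqcap y$; $x\sqcap y=y\sqcap x$; $x\sqcap(y\sqcap z)=(x\sqcap y)\sqcap z$; $\neg(x\sqcap x)=\neg x$; $x\sqcap(x\sqcup y)=x\sqcap x$; $x\sqcap(y\vee z)=(x\sqcap y)\vee(x\sqcap z)$; $x\sqcap(x\vee y)=x\sqcap x$; $\neg\neg(x\sqcap y)=x\sqcap y$; $x\sqcap\neg x=\bot$; $\neg\bot=\top\sqcap\top$; $\neg\top=\bot$; the duals $(x\sqcup x)\sqcup y=x\sqcup y$; $x\sqcup y=y\sqcup x$; $x\sqcup(y\sqcup z)=(x\sqcup y)\sqcup z$; $\lrcorner(x\sqcup x)=\lrcorner x$; $x\sqcup(x\sqcap y)=x\sqcup x$; $x\sqcup(y\wedge z)=(x\sqcup y)\wedge(x\sqcup z)$; $x\sqcup(x\wedge y)=x\sqcup x$;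 $\lrcorner\lrcorner(x\sqcup y)=x\sqcup y$; $x\sqcup\lrcorner x=\top$; $\lrcorner\top=\bot\sqcup\bot$; $\lrcorner\bot=\top$; and $(x\sqcap x)\sqcup(x\sqcap x)=(x\sqcup x)\sqcap(x\sqcup x)$. The quasi-order is $x\sqsubseteq y$ iff $x\sqcap y=x\sqcap x$ and $x\sqcup y=y\sqcup y$. $x_\sqcap:=x\sqcap x$, $x_\sqcup:=x\sqcup x$, $D_\sqcap:=\{x:x_\sqcap=x\}$, $D_\sqcup:=\{x:x_\sqcup=x\}$, $D_p:=D_\sqcap\cup D_\sqcup$; $\mathbf D_p$ is the subalgebra of $\mathbf D$ with universe $D_p$ (it is closed under all operations). $\mathbf D$ is fully contextual if $\sqsubseteq$ is a partial order and for all $y\in D_\sqcap$, $x\in D_\sqcup$ with $y_\sqcup=x_\sqcap$ there is a unique $z\in D$ with $z_\sqcap=y$, $z_\sqcup=x$. A dBa isomorphism is a bijection preserving $\sqcup,\sqcap,\neg,\lrcorner,\top,\bot$. *)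

theory Defs
  imports "HOL-Algebra.Congruence"
begin

record 'a dba = "'a partial_object" +
  dba_join :: "'a \<Rightarrow> 'a \<Rightarrow> 'a"  (infixl \<open>\<squnion>\<index>\<close> 65)
  dba_meet :: "'a \<Rightarrow> 'a \<Rightarrow> 'a"  (infixl \<open>\<sqinter>\<index>\<close> 70)
  dba_neg :: "'a \<Rightarrow> 'a"  (\<open>\<sim>\<index>_\<close> [81] 80)
  dba_opp :: "'a \<Rightarrow> 'a"  (\<open>\<lrcorner>\<index>_\<close> [81] 80)
  dba_top :: 'a  (\<open>\<top>\<index>\<close>)
  dba_bot :: 'a  (\<open>\<bottom>\<index>\<close>)

definition dba_vee :: "('a, 'm) dba_scheme \<Rightarrow> 'a \<Rightarrow> 'a \<Rightarrow> 'a"  (infixl \<open>\<curlyvee>\<index>\<close> 65)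
  where "x \<curlyvee>\<^bsub>D\<^esub> y = \<sim>\<^bsub>D\<^esub> (\<sim>\<^bsub>D\<^esub> x \<sqinter>\<^bsub>D\<^esub> \<sim>\<^bsub>D\<^esub> y)"

definition dba_wedge :: "('a, 'm) dba_scheme \<Rightarrow> 'a \<Rightarrow> 'a \<Rightarrow> 'a"  (infixl \<open>\<curlywedge>\<index>\<close> 70)
  where "x \<curlywedge>\<^bsub>D\<^esub> y = \<lrcorner>\<^bsub>D\<^esub> (\<lrcorner>\<^bsub>D\<^esub> x \<squnion>\<^bsub>D\<^esub> \<lrcorner>\<^bsub>D\<^esub> y)"

definition dba_le :: "('a, 'm) dba_scheme \<Rightarrow> 'a \<Rightarrow> 'a \<Rightarrow> bool"  (infix \<open>\<sqsubseteq>\<index>\<close> 50)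
  where "x \<sqsubseteq>\<^bsub>D\<^esub> y \<longleftrightarrow>
    x \<sqinter>\<^bsub>D\<^esub> y = x \<sqinter>\<^bsub>D\<^esub> x \<and> x \<squnion>\<^bsub>D\<^esub> y = y \<squnion>\<^bsub>D\<^esub> y"

locale double_boolean_algebra =
  fixes D (structure)
  assumes join_closed: "\<lbrakk>x \<in> carrier D; y \<in> carrier D\<rbrakk> \<Longrightarrow> x \<squnion> y \<in> carrier D"
    and meet_closed: "\<lbrakk>x \<in> carrier D; y \<in> carrier D\<rbrakk> \<Longrightarrow> x \<sqinter> y \<in> carrier D"
    and neg_closed: "x \<in> carrier D \<Longrightarrow> \<sim> x \<in> carrier D"
    and opp_closed: "x \<in> carrier D \<Longrightarrow> \<lrcorner> x \<in> carrier D"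
    and top_closed: "\<top> \<in> carrier D"
    and bot_closed: "\<bottom> \<in> carrier D"
    and meet_idem_left: "\<lbrakk>x \<in> carrier D; y \<in> carrier D\<rbrakk> \<Longrightarrow> (x \<sqinter> x) \<sqinter> y = x \<sqinter> y"
    and meet_comm: "\<lbrakk>x \<in> carrier D; y \<in> carrier D\<rbrakk> \<Longrightarrow> x \<sqinter> y = y \<sqinter> x"
    and meet_assoc: "\<lbrakk>x \<in> carrier D; y \<in> carrier D; z \<in> carrier D\<rbrakk> \<Longrightarrow>
          x \<sqinter> (y \<sqinter> z) = (x \<sqinter> y) \<sqinter> z"
    and neg_meet_self: "x \<in> carrier D \<Longrightarrow> \<sim> (x \<sqinter> x) = \<sim> x"
    and meet_join_absorb: "\<lbrakk>x \<in> carrier D; y \<in> carrier D\<rbrakk> \<Longrightarrow> x \<sqinter> (x \<squnion> y) = x \<sqinter> x"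
    and meet_vee_distrib: "\<lbrakk>x \<in> carrier D; y \<in> carrier D; z \<in> carrier D\<rbrakk> \<Longrightarrow>
          x \<sqinter> (y \<curlyvee> z) = (x \<sqinter> y) \<curlyvee> (x \<sqinter> z)"
    and meet_vee_absorb: "\<lbrakk>x \<in> carrier D; y \<in> carrier D\<rbrakk> \<Longrightarrow> x \<sqinter> (x \<curlyvee> y) = x \<sqinter> x"
    and neg_neg_meet: "\<lbrakk>x \<in> carrier D; y \<in> carrier D\<rbrakk> \<Longrightarrow> \<sim> (\<sim> (x \<sqinter> y)) = x \<sqinter> y"
    and meet_neg: "x \<in> carrier D \<Longrightarrow> x \<sqinter> \<sim> x = \<bottom>"
    and neg_bot: "\<sim> \<bottom> = \<top> \<sqinter> \<top>"
    and neg_top: "\<sim> \<top> = \<bottom>"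
    and join_idem_left: "\<lbrakk>x \<in> carrier D; y \<in> carrier D\<rbrakk> \<Longrightarrow> (x \<squnion> x) \<squnion> y = x \<squnion> y"
    and join_comm: "\<lbrakk>x \<in> carrier D; y \<in> carrier D\<rbrakk> \<Longrightarrow> x \<squnion> y = y \<squnion> x"
    and join_assoc: "\<lbrakk>x \<in> carrier D; y \<in> carrier D; z \<in> carrier D\<rbrakk> \<Longrightarrow>
          x \<squnion> (y \<squnion> z) = (x \<squnion> y) \<squnion> z"
    and opp_join_self: "x \<in> carrier D \<Longrightarrow> \<lrcorner> (x \<squnion> x) = \<lrcorner> x"
    and join_meet_absorb: "\<lbrakk>x \<in> carrier D; y \<in> carrier D\<rbrakk> \<Longrightarrow> x \<squnion> (x \<sqinter> y) = x \<squnion> x"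
    and join_wedge_distrib: "\<lbrakk>x \<in> carrier D; y \<in> carrier D; z \<in> carrier D\<rbrakk> \<Longrightarrow>
          x \<squnion> (y \<curlywedge> z) = (x \<squnion> y) \<curlywedge> (x \<squnion> z)"
    and join_wedge_absorb: "\<lbrakk>x \<in> carrier D; y \<in> carrier D\<rbrakk> \<Longrightarrow> x \<squnion> (x \<curlywedge> y) = x \<squnion> x"
    and opp_opp_join: "\<lbrakk>x \<in> carrier D; y \<in> carrier D\<rbrakk> \<Longrightarrow> \<lrcorner> (\<lrcorner> (x \<squnion> y)) = x \<squnion> y"
    and join_opp: "x \<in> carrier D \<Longrightarrow> x \<squnion> \<lrcorner> x = \<top>"
    and opp_top: "\<lrcorner> \<top> = \<bottom> \<squnion> \<bottom>"
    and opp_bot: "\<lrcorner> \<bottom> = \<top>"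
    and meet_join_self: "x \<in> carrier D \<Longrightarrow>
          (x \<sqinter> x) \<squnion> (x \<sqinter> x) = (x \<squnion> x) \<sqinter> (x \<squnion> x)"

definition dba_meet_part :: "('a, 'm) dba_scheme \<Rightarrow> 'a set"
  where "dba_meet_part D = {x \<in> carrier D. x \<sqinter>\<^bsub>D\<^esub> x = x}"

definition dba_join_part :: "('a, 'm) dba_scheme \<Rightarrow> 'a set"
  where "dba_join_part D = {x \<in> carrier D. x \<squnion>\<^bsub>D\<^esub> x = x}"

definition dba_pure :: "('a, 'm) dba_scheme \<Rightarrow> ('a, 'm) dba_scheme"
  where "dba_pure D = D\<lparr>carrier := dba_meet_part D \<union> dba_join_part D\<rparr>"

locale fully_contextual_dba = double_boolean_algebra +
  assumes le_partial_order:
      "partial_order_on (carrier D) {(x, y). x \<in> carrier D \<and> y \<in> carrier D \<and> x \<sqsubseteq> y}"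
    and contextual:
      "\<lbrakk>y \<in> dba_meet_part D; x \<in> dba_join_part D; y \<squnion> y = x \<sqinter> x\<rbrakk> \<Longrightarrow>
        \<exists>!z. z \<in> carrier D \<and> z \<sqinter> z = y \<and> z \<squnion> z = x"

definition dba_iso :: "('a, 'm) dba_scheme \<Rightarrow> ('b, 'n) dba_scheme \<Rightarrow> ('a \<Rightarrow> 'b) set"
  where "dba_iso D M = {h. bij_betw h (carrier D) (carrier M) \<and>
    (\<forall>x\<in>carrier D. \<forall>y\<in>carrier D. h (x \<squnion>\<^bsub>D\<^esub> y) = h x \<squnion>\<^bsub>M\<^esub> h y) \<and>
    (\<forall>x\<in>carrier D. \<forall>y\<in>carrier D. h (x \<sqinter>\<^bsub>D\<^esub> y) = h x \<sqinter>\<^bsub>M\<^esub> h y) \<and>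
    (\<forall>x\<in>carrier D. h (\<sim>\<^bsub>D\<^esub> x) = \<sim>\<^bsub>M\<^esub> (h x)) \<and>
    (\<forall>x\<in>carrier D. h (\<lrcorner>\<^bsub>D\<^esub> x) = \<lrcorner>\<^bsub>M\<^esub> (h x)) \<and>
    h \<top>\<^bsub>D\<^esub> = \<top>\<^bsub>M\<^esub> \<and> h \<bottom>\<^bsub>D\<^esub> = \<bottom>\<^bsub>M\<^esub>}"

definition dba_isomorphic :: "('a, 'm) dba_scheme \<Rightarrow> ('b, 'n) dba_scheme \<Rightarrow> bool"
  where "dba_isomorphic D M \<longleftrightarrow> dba_iso D M \<noteq> {}"

context double_boolean_algebra
begin

lemma meet_in_meet_part:
  assumes "x \<in> carrier D" "y \<in> carrier D"
  shows "x \<sqinter> y \<in> dba_meet_part D"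
proof -
  have "(x \<sqinter> y) \<sqinter> (x \<sqinter> y) = (x \<sqinter> x) \<sqinter> (y \<sqinter> y)"
    using assms by (metis meet_assoc meet_comm meet_closed)
  also have "\<dots> = x \<sqinter> y"
    using assms by (metis meet_idem_left meet_comm meet_closed)
  finally show ?thesis
    using assms by (simp add: dba_meet_part_def meet_closed)
qed

lemma join_in_join_part:
  assumes "x \<in> carrier D" "y \<in> carrier D"
  shows "x \<squnion> y \<in> dba_join_part D"
proof -
  have "(x \<squnion> y) \<squnion> (x \<squnion> y) = (x \<squnion> x) \<squnion> (y \<squnion> y)"
    using assms by (metis join_assoc join_comm join_closed)
  also have "\<dots> = x \<squnion> y"
    using assms by (metis join_idem_left join_comm join_closed)
  finally show ?thesis
    using assms by (simp add: dba_join_part_def join_closed)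
qed

lemma neg_in_meet_part:
  assumes "x \<in> carrier D"
  shows "\<sim> x \<in> dba_meet_part D"
  using assms by (metis meet_in_meet_part neg_closed neg_meet_self neg_neg_meet)

lemma opp_in_join_part:
  assumes "x \<in> carrier D"
  shows "\<lrcorner> x \<in> dba_join_part D"
  using assms by (metis join_in_join_part opp_closed opp_join_self opp_opp_join)

lemma dba_pure_subalgebra: "double_boolean_algebra (dba_pure D)"
proof -
  let ?P = "dba_meet_part D \<union> dba_join_part D"
  have sub: "x \<in> carrier D" if "x \<in> ?P" for x
    using that by (auto simp: dba_meet_part_def dba_join_part_def)
  have bot: "\<bottom> \<in> ?P"
    using neg_in_meet_part[OF top_closed] by (simp add: neg_top)
  have top: "\<top> \<in> ?P"
    using opp_in_join_part[OF bot_closed] by (simp add: opp_bot)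
  note [simp] = dba_pure_def dba_vee_def dba_wedge_def
  show ?thesis
    apply (unfold_locales; simp del: Un_iff)
    subgoal using sub join_in_join_part by blast
    subgoal using sub meet_in_meet_part by blast
    subgoal using sub neg_in_meet_part by blast
    subgoal using sub opp_in_join_part by blast
    subgoal by (rule top)
    subgoal by (rule bot)
    subgoal by (intro meet_idem_left sub)
    subgoal by (intro meet_comm sub)
    subgoal by (intro meet_assoc sub)
    subgoal by (intro neg_meet_self sub)
    subgoal by (intro meet_join_absorb sub)
    subgoal by (intro meet_vee_distrib[unfolded dba_vee_def] sub)
    subgoal by (intro meet_vee_absorb[unfolded dba_vee_def] sub)
    subgoal by (intro neg_neg_meet sub)
    subgoal by (intro meet_neg sub)
    subgoal by (rule neg_bot)
    subgoal by (rule neg_top)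
    subgoal by (intro join_idem_left sub)
    subgoal by (intro join_comm sub)
    subgoal by (intro join_assoc sub)
    subgoal by (intro opp_join_self sub)
    subgoal by (intro join_meet_absorb sub)
    subgoal by (intro join_wedge_distrib[unfolded dba_wedge_def] sub)
    subgoal by (intro join_wedge_absorb[unfolded dba_wedge_def] sub)
    subgoal by (intro opp_opp_join sub)
    subgoal by (intro join_opp sub)
    subgoal by (rule opp_top)
    subgoal by (rule opp_bot)
    subgoal by (intro meet_join_self sub)
    done
qed

end

end

theory Submission
  imports Defs
begin

text \<open>
  An element \<open>z\<close> of a fully contextual algebra is determined by the pair
  \<open>(z \<sqinter> z, z \<squnion> z)\<close>, and the pairs \<open>(a, b)\<close> that occur are those with \<open>a\<close> in the meet part,
  \<open>b\<close> in the join part and \<open>a \<squnion> a = b \<sqinter> b\<close>. A homomorphism of pure parts acts on such pairs, which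
  gives the only possible extension; it is a homomorphism because every operation takes values in
  the pure part and depends on its arguments only through \<open>z \<sqinter> z\<close> or \<open>z \<squnion> z\<close>. As extensions of
  homomorphisms are unique, the extensions of two mutually inverse isomorphisms are mutually inverse.
\<close>

lemma carrier_dba_pure [simp]: "carrier (dba_pure D) = dba_meet_part D \<union> dba_join_part D"
  and dba_pure_ops [simp]:
    "x \<squnion>\<^bsub>dba_pure D\<^esub> y = x \<squnion>\<^bsub>D\<^esub> y" "x \<sqinter>\<^bsub>dba_pure D\<^esub> y = x \<sqinter>\<^bsub>D\<^esub> y"
    "\<sim>\<^bsub>dba_pure D\<^esub> x = \<sim>\<^bsub>D\<^esub> x" "\<lrcorner>\<^bsub>dba_pure D\<^esub> x = \<lrcorner>\<^bsub>D\<^esub> x"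
    "\<top>\<^bsub>dba_pure D\<^esub> = \<top>\<^bsub>D\<^esub>" "\<bottom>\<^bsub>dba_pure D\<^esub> = \<bottom>\<^bsub>D\<^esub>"
  by (simp_all add: dba_pure_def)

lemma carrier_dba_pureD: "x \<in> carrier (dba_pure D) \<Longrightarrow> x \<in> carrier D"
  by (auto simp: dba_meet_part_def dba_join_part_def)

lemma meet_part_dba_pure [simp]: "dba_meet_part (dba_pure D) = dba_meet_part D"
  and join_part_dba_pure [simp]: "dba_join_part (dba_pure D) = dba_join_part D"
  by (auto simp: dba_meet_part_def[of "dba_pure D"] dba_join_part_def[of "dba_pure D"])
    (auto simp: dba_meet_part_def dba_join_part_def)

context double_boolean_algebra
begin

lemma meet_self_meet_self:
  "\<lbrakk>x \<in> carrier D; y \<in> carrier D\<rbrakk> \<Longrightarrow> (x \<sqinter> x) \<sqinter> (y \<sqinter> y) = x \<sqinter> y"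
  by (metis meet_idem_left meet_comm meet_closed)

lemma join_self_join_self:
  "\<lbrakk>x \<in> carrier D; y \<in> carrier D\<rbrakk> \<Longrightarrow> (x \<squnion> x) \<squnion> (y \<squnion> y) = x \<squnion> y"
  by (metis join_idem_left join_comm join_closed)

end

lemma (in fully_contextual_dba) eq_if_meet_self_eq_join_self_eq:
  assumes "x \<in> carrier D" "y \<in> carrier D" "x \<sqinter> x = y \<sqinter> y" "x \<squnion> x = y \<squnion> y"
  shows "x = y"
  using contextual[of "y \<sqinter> y" "y \<squnion> y"] assms
  by (metis join_in_join_part meet_in_meet_part meet_join_self)

definition dba_hom :: "('a, 'm) dba_scheme \<Rightarrow> ('b, 'n) dba_scheme \<Rightarrow> ('a \<Rightarrow> 'b) set"
  where "dba_hom D M = {h \<in> carrier D \<rightarrow> carrier M.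
    (\<forall>x\<in>carrier D. \<forall>y\<in>carrier D. h (x \<squnion>\<^bsub>D\<^esub> y) = h x \<squnion>\<^bsub>M\<^esub> h y) \<and>
    (\<forall>x\<in>carrier D. \<forall>y\<in>carrier D. h (x \<sqinter>\<^bsub>D\<^esub> y) = h x \<sqinter>\<^bsub>M\<^esub> h y) \<and>
    (\<forall>x\<in>carrier D. h (\<sim>\<^bsub>D\<^esub> x) = \<sim>\<^bsub>M\<^esub> (h x)) \<and>
    (\<forall>x\<in>carrier D. h (\<lrcorner>\<^bsub>D\<^esub> x) = \<lrcorner>\<^bsub>M\<^esub> (h x)) \<and>
    h \<top>\<^bsub>D\<^esub> = \<top>\<^bsub>M\<^esub> \<and> h \<bottom>\<^bsub>D\<^esub> = \<bottom>\<^bsub>M\<^esub>}"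

lemma dba_homI:
  assumes "\<And>x. x \<in> carrier D \<Longrightarrow> h x \<in> carrier M"
    and "\<And>x y. \<lbrakk>x \<in> carrier D; y \<in> carrier D\<rbrakk> \<Longrightarrow> h (x \<squnion>\<^bsub>D\<^esub> y) = h x \<squnion>\<^bsub>M\<^esub> h y"
    and "\<And>x y. \<lbrakk>x \<in> carrier D; y \<in> carrier D\<rbrakk> \<Longrightarrow> h (x \<sqinter>\<^bsub>D\<^esub> y) = h x \<sqinter>\<^bsub>M\<^esub> h y"
    and "\<And>x. x \<in> carrier D \<Longrightarrow> h (\<sim>\<^bsub>D\<^esub> x) = \<sim>\<^bsub>M\<^esub> (h x)"
    and "\<And>x. x \<in> carrier D \<Longrightarrow> h (\<lrcorner>\<^bsub>D\<^esub> x) = \<lrcorner>\<^bsub>M\<^esub> (h x)"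
    and "h \<top>\<^bsub>D\<^esub> = \<top>\<^bsub>M\<^esub>" and "h \<bottom>\<^bsub>D\<^esub> = \<bottom>\<^bsub>M\<^esub>"
  shows "h \<in> dba_hom D M"
  using assms by (simp add: dba_hom_def)

lemma
  assumes "h \<in> dba_hom D M"
  shows dba_hom_closed: "x \<in> carrier D \<Longrightarrow> h x \<in> carrier M"
    and dba_hom_join: "\<lbrakk>x \<in> carrier D; y \<in> carrier D\<rbrakk> \<Longrightarrow> h (x \<squnion>\<^bsub>D\<^esub> y) = h x \<squnion>\<^bsub>M\<^esub> h y"
    and dba_hom_meet: "\<lbrakk>x \<in> carrier D; y \<in> carrier D\<rbrakk> \<Longrightarrow> h (x \<sqinter>\<^bsub>D\<^esub> y) = h x \<sqinter>\<^bsub>M\<^esub> h y"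
    and dba_hom_neg: "x \<in> carrier D \<Longrightarrow> h (\<sim>\<^bsub>D\<^esub> x) = \<sim>\<^bsub>M\<^esub> (h x)"
    and dba_hom_opp: "x \<in> carrier D \<Longrightarrow> h (\<lrcorner>\<^bsub>D\<^esub> x) = \<lrcorner>\<^bsub>M\<^esub> (h x)"
    and dba_hom_top: "h \<top>\<^bsub>D\<^esub> = \<top>\<^bsub>M\<^esub>"
    and dba_hom_bot: "h \<bottom>\<^bsub>D\<^esub> = \<bottom>\<^bsub>M\<^esub>"
  using assms by (auto simp: dba_hom_def)

lemma dba_hom_id: "id \<in> dba_hom D D"
  by (simp add: dba_hom_def)

lemma dba_hom_comp:
  assumes "h \<in> dba_hom D M" "k \<in> dba_hom M N"
  shows "k \<circ> h \<in> dba_hom D N"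
  using assms by (auto simp: dba_hom_def Pi_iff)

lemma
  assumes "h \<in> dba_hom D M"
  shows dba_hom_meet_part: "x \<in> dba_meet_part D \<Longrightarrow> h x \<in> dba_meet_part M"
    and dba_hom_join_part: "x \<in> dba_join_part D \<Longrightarrow> h x \<in> dba_join_part M"
  using dba_hom_closed[OF assms, of x] dba_hom_meet[OF assms, of x x] dba_hom_join[OF assms, of x x]
  by (simp_all add: dba_meet_part_def dba_join_part_def)

lemma dba_hom_pure:
  assumes "h \<in> dba_hom D M"
  shows "h \<in> dba_hom (dba_pure D) (dba_pure M)"
proof (rule dba_homI)
  show "h x \<in> carrier (dba_pure M)" if "x \<in> carrier (dba_pure D)" for x
    using that dba_hom_meet_part[OF assms] dba_hom_join_part[OF assms] by auto
qed (simp_all add: carrier_dba_pureD dba_hom_join[OF assms] dba_hom_meet[OF assms]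
  dba_hom_neg[OF assms] dba_hom_opp[OF assms] dba_hom_top[OF assms] dba_hom_bot[OF assms]
  del: carrier_dba_pure)

lemma dba_iso_iff: "h \<in> dba_iso D M \<longleftrightarrow> h \<in> dba_hom D M \<and> bij_betw h (carrier D) (carrier M)"
  by (auto simp: dba_iso_def dba_hom_def dest: bij_betw_imp_funcset)

lemma dba_isoI_inverse:
  assumes "h \<in> dba_hom D M" "k \<in> dba_hom M D"
    and "\<And>x. x \<in> carrier D \<Longrightarrow> k (h x) = x" "\<And>y. y \<in> carrier M \<Longrightarrow> h (k y) = y"
  shows "h \<in> dba_iso D M"
  unfolding dba_iso_iff
  using assms by (auto intro!: bij_betw_byWitness[where f' = k] dest: dba_hom_closed)

lemma dba_hom_inv_into:
  assumes "double_boolean_algebra D" and iso: "h \<in> dba_iso D M"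
  shows "inv_into (carrier D) h \<in> dba_hom M D"
proof -
  interpret double_boolean_algebra D by fact
  let ?k = "inv_into (carrier D) h"
  have hom: "h \<in> dba_hom D M" and bij: "bij_betw h (carrier D) (carrier M)"
    using iso by (simp_all add: dba_iso_iff)
  have closed: "?k y \<in> carrier D" and right: "h (?k y) = y" if "y \<in> carrier M" for y
    using bij that by (auto simp: bij_betw_def inv_into_into f_inv_into_f)
  have inv_eqI: "?k y = x" if "x \<in> carrier D" "h x = y" for x y
    using bij_betw_inv_into_left[OF bij] that by blast
  show ?thesis
    by (intro dba_homI inv_eqI)
      (simp_all add: closed right dba_hom_join[OF hom] dba_hom_meet[OF hom] dba_hom_neg[OF hom]
        dba_hom_opp[OF hom] dba_hom_top[OF hom] dba_hom_bot[OF hom]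
        join_closed meet_closed neg_closed opp_closed top_closed bot_closed)
qed

lemma dba_isoE_inverse:
  assumes "double_boolean_algebra D" "h \<in> dba_iso D M"
  obtains k where "h \<in> dba_hom D M" "k \<in> dba_hom M D"
    "\<And>x. x \<in> carrier D \<Longrightarrow> k (h x) = x" "\<And>y. y \<in> carrier M \<Longrightarrow> h (k y) = y"
proof
  show "h \<in> dba_hom D M" "inv_into (carrier D) h \<in> dba_hom M D"
    using assms by (simp_all add: dba_iso_iff dba_hom_inv_into)
  have bij: "bij_betw h (carrier D) (carrier M)"
    using assms(2) by (simp add: dba_iso_iff)
  show "inv_into (carrier D) h (h x) = x" if "x \<in> carrier D" for x
    using bij that by (rule bij_betw_inv_into_left)
  show "h (inv_into (carrier D) h y) = y" if "y \<in> carrier M" for y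
    using bij that by (rule bij_betw_inv_into_right)
qed

lemma dba_iso_pure:
  assumes "double_boolean_algebra D" "h \<in> dba_iso D M"
  shows "h \<in> dba_iso (dba_pure D) (dba_pure M)"
proof -
  obtain k where "h \<in> dba_hom D M" "k \<in> dba_hom M D"
    and "\<And>x. x \<in> carrier D \<Longrightarrow> k (h x) = x" "\<And>y. y \<in> carrier M \<Longrightarrow> h (k y) = y"
    using assms by (rule dba_isoE_inverse) blast
  then show ?thesis
    by (intro dba_isoI_inverse[where k = k] dba_hom_pure)
      (simp_all add: carrier_dba_pureD del: carrier_dba_pure)
qed

lemma dba_hom_eq_if_eq_on_pure:
  assumes "double_boolean_algebra D" "fully_contextual_dba M"
    and g: "g \<in> dba_hom D M" and h: "h \<in> dba_hom D M"
    and eq: "\<And>x. x \<in> carrier (dba_pure D) \<Longrightarrow> g x = h x"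
    and x: "x \<in> carrier D"
  shows "g x = h x"
proof -
  interpret D: double_boolean_algebra D by fact
  interpret M: fully_contextual_dba M by fact
  show ?thesis
  proof (rule M.eq_if_meet_self_eq_join_self_eq)
    show "g x \<in> carrier M" "h x \<in> carrier M"
      using g h x by (simp_all add: dba_hom_closed)
    show "g x \<sqinter>\<^bsub>M\<^esub> g x = h x \<sqinter>\<^bsub>M\<^esub> h x"
      using eq[of "x \<sqinter>\<^bsub>D\<^esub> x"] x
      by (simp add: D.meet_in_meet_part dba_hom_meet[OF g] dba_hom_meet[OF h])
    show "g x \<squnion>\<^bsub>M\<^esub> g x = h x \<squnion>\<^bsub>M\<^esub> h x"
      using eq[of "x \<squnion>\<^bsub>D\<^esub> x"] x
      by (simp add: D.join_in_join_part dba_hom_join[OF g] dba_hom_join[OF h])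
  qed
qed

definition pure_extension ::
    "('a, 'm) dba_scheme \<Rightarrow> ('b, 'n) dba_scheme \<Rightarrow> ('a \<Rightarrow> 'b) \<Rightarrow> 'a \<Rightarrow> 'b"
  where "pure_extension D M f = (\<lambda>z\<in>carrier D. THE w. w \<in> carrier M \<and>
    w \<sqinter>\<^bsub>M\<^esub> w = f (z \<sqinter>\<^bsub>D\<^esub> z) \<and> w \<squnion>\<^bsub>M\<^esub> w = f (z \<squnion>\<^bsub>D\<^esub> z))"

lemma pure_extension_extensional: "pure_extension D M f \<in> extensional (carrier D)"
  by (simp add: pure_extension_def)

locale dba_pure_hom =
  D: double_boolean_algebra D + M: fully_contextual_dba M
  for D :: "('a, 'm) dba_scheme" and M :: "('b, 'n) dba_scheme" +
  fixes f :: "'a \<Rightarrow> 'b"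
  assumes hom: "f \<in> dba_hom (dba_pure D) (dba_pure M)"
begin

lemma ex1_meet_self_join_self_image:
  assumes z: "z \<in> carrier D"
  shows "\<exists>!w. w \<in> carrier M \<and> w \<sqinter>\<^bsub>M\<^esub> w = f (z \<sqinter>\<^bsub>D\<^esub> z) \<and> w \<squnion>\<^bsub>M\<^esub> w = f (z \<squnion>\<^bsub>D\<^esub> z)"
proof (rule M.contextual)
  have meet: "z \<sqinter>\<^bsub>D\<^esub> z \<in> dba_meet_part D" and join: "z \<squnion>\<^bsub>D\<^esub> z \<in> dba_join_part D"
    using z by (simp_all add: D.meet_in_meet_part D.join_in_join_part)
  show "f (z \<sqinter>\<^bsub>D\<^esub> z) \<in> dba_meet_part M" "f (z \<squnion>\<^bsub>D\<^esub> z) \<in> dba_join_part M"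
    using meet join dba_hom_meet_part[OF hom] dba_hom_join_part[OF hom] by simp_all
  have "f (z \<sqinter>\<^bsub>D\<^esub> z) \<squnion>\<^bsub>M\<^esub> f (z \<sqinter>\<^bsub>D\<^esub> z) = f ((z \<sqinter>\<^bsub>D\<^esub> z) \<squnion>\<^bsub>D\<^esub> (z \<sqinter>\<^bsub>D\<^esub> z))"
    using meet dba_hom_join[OF hom] by simp
  also have "\<dots> = f ((z \<squnion>\<^bsub>D\<^esub> z) \<sqinter>\<^bsub>D\<^esub> (z \<squnion>\<^bsub>D\<^esub> z))"
    using z by (simp add: D.meet_join_self)
  also have "\<dots> = f (z \<squnion>\<^bsub>D\<^esub> z) \<sqinter>\<^bsub>M\<^esub> f (z \<squnion>\<^bsub>D\<^esub> z)"
    using join dba_hom_meet[OF hom] by simp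
  finally show "f (z \<sqinter>\<^bsub>D\<^esub> z) \<squnion>\<^bsub>M\<^esub> f (z \<sqinter>\<^bsub>D\<^esub> z) = f (z \<squnion>\<^bsub>D\<^esub> z) \<sqinter>\<^bsub>M\<^esub> f (z \<squnion>\<^bsub>D\<^esub> z)" .
qed

lemma
  assumes "z \<in> carrier D"
  shows pure_extension_closed: "pure_extension D M f z \<in> carrier M"
    and pure_extension_meet_self:
      "pure_extension D M f z \<sqinter>\<^bsub>M\<^esub> pure_extension D M f z = f (z \<sqinter>\<^bsub>D\<^esub> z)"
    and pure_extension_join_self:
      "pure_extension D M f z \<squnion>\<^bsub>M\<^esub> pure_extension D M f z = f (z \<squnion>\<^bsub>D\<^esub> z)"
  using theI'[OF ex1_meet_self_join_self_image[OF assms]] assms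
  by (simp_all add: pure_extension_def)

lemma pure_extension_eq_on_pure:
  assumes x: "x \<in> carrier (dba_pure D)"
  shows "pure_extension D M f x = f x"
proof (rule M.eq_if_meet_self_eq_join_self_eq)
  have "x \<in> carrier D"
    using x by (rule carrier_dba_pureD)
  then show "pure_extension D M f x \<in> carrier M"
    and "pure_extension D M f x \<sqinter>\<^bsub>M\<^esub> pure_extension D M f x = f x \<sqinter>\<^bsub>M\<^esub> f x"
    and "pure_extension D M f x \<squnion>\<^bsub>M\<^esub> pure_extension D M f x = f x \<squnion>\<^bsub>M\<^esub> f x"
    using dba_hom_meet[OF hom x x] dba_hom_join[OF hom x x]
    by (simp_all add: pure_extension_closed pure_extension_meet_self pure_extension_join_self)
  show "f x \<in> carrier M"
    using dba_hom_closed[OF hom x] by (rule carrier_dba_pureD)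
qed

lemma pure_extension_join:
  assumes x: "x \<in> carrier D" and y: "y \<in> carrier D"
  shows "pure_extension D M f (x \<squnion>\<^bsub>D\<^esub> y) =
    pure_extension D M f x \<squnion>\<^bsub>M\<^esub> pure_extension D M f y"
proof -
  let ?g = "pure_extension D M f"
  have "?g (x \<squnion>\<^bsub>D\<^esub> y) = f ((x \<squnion>\<^bsub>D\<^esub> x) \<squnion>\<^bsub>D\<^esub> (y \<squnion>\<^bsub>D\<^esub> y))"
    using x y by (simp add: pure_extension_eq_on_pure D.join_in_join_part D.join_self_join_self)
  also have "\<dots> = (?g x \<squnion>\<^bsub>M\<^esub> ?g x) \<squnion>\<^bsub>M\<^esub> (?g y \<squnion>\<^bsub>M\<^esub> ?g y)"
    using x y dba_hom_join[OF hom] by (simp add: D.join_in_join_part pure_extension_join_self)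
  finally show ?thesis
    using x y by (simp add: M.join_self_join_self pure_extension_closed)
qed

lemma pure_extension_meet:
  assumes x: "x \<in> carrier D" and y: "y \<in> carrier D"
  shows "pure_extension D M f (x \<sqinter>\<^bsub>D\<^esub> y) =
    pure_extension D M f x \<sqinter>\<^bsub>M\<^esub> pure_extension D M f y"
proof -
  let ?g = "pure_extension D M f"
  have "?g (x \<sqinter>\<^bsub>D\<^esub> y) = f ((x \<sqinter>\<^bsub>D\<^esub> x) \<sqinter>\<^bsub>D\<^esub> (y \<sqinter>\<^bsub>D\<^esub> y))"
    using x y by (simp add: pure_extension_eq_on_pure D.meet_in_meet_part D.meet_self_meet_self)
  also have "\<dots> = (?g x \<sqinter>\<^bsub>M\<^esub> ?g x) \<sqinter>\<^bsub>M\<^esub> (?g y \<sqinter>\<^bsub>M\<^esub> ?g y)"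
    using x y dba_hom_meet[OF hom] by (simp add: D.meet_in_meet_part pure_extension_meet_self)
  finally show ?thesis
    using x y by (simp add: M.meet_self_meet_self pure_extension_closed)
qed

lemma pure_extension_neg:
  assumes x: "x \<in> carrier D"
  shows "pure_extension D M f (\<sim>\<^bsub>D\<^esub> x) = \<sim>\<^bsub>M\<^esub> (pure_extension D M f x)"
proof -
  let ?g = "pure_extension D M f"
  have "?g (\<sim>\<^bsub>D\<^esub> x) = f (\<sim>\<^bsub>D\<^esub> (x \<sqinter>\<^bsub>D\<^esub> x))"
    using x by (simp add: pure_extension_eq_on_pure D.neg_in_meet_part D.neg_meet_self)
  also have "\<dots> = \<sim>\<^bsub>M\<^esub> (?g x \<sqinter>\<^bsub>M\<^esub> ?g x)"
    using x dba_hom_neg[OF hom] by (simp add: D.meet_in_meet_part pure_extension_meet_self)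
  finally show ?thesis
    using x by (simp add: M.neg_meet_self pure_extension_closed)
qed

lemma pure_extension_opp:
  assumes x: "x \<in> carrier D"
  shows "pure_extension D M f (\<lrcorner>\<^bsub>D\<^esub> x) = \<lrcorner>\<^bsub>M\<^esub> (pure_extension D M f x)"
proof -
  let ?g = "pure_extension D M f"
  have "?g (\<lrcorner>\<^bsub>D\<^esub> x) = f (\<lrcorner>\<^bsub>D\<^esub> (x \<squnion>\<^bsub>D\<^esub> x))"
    using x by (simp add: pure_extension_eq_on_pure D.opp_in_join_part D.opp_join_self)
  also have "\<dots> = \<lrcorner>\<^bsub>M\<^esub> (?g x \<squnion>\<^bsub>M\<^esub> ?g x)"
    using x dba_hom_opp[OF hom] by (simp add: D.join_in_join_part pure_extension_join_self)
  finally show ?thesis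
    using x by (simp add: M.opp_join_self pure_extension_closed)
qed

lemma pure_extension_hom: "pure_extension D M f \<in> dba_hom D M"
proof (rule dba_homI)
  interpret pure: double_boolean_algebra "dba_pure D"
    by (rule D.dba_pure_subalgebra)
  show "pure_extension D M f \<top>\<^bsub>D\<^esub> = \<top>\<^bsub>M\<^esub>"
    using pure_extension_eq_on_pure[OF pure.top_closed] dba_hom_top[OF hom] by simp
  show "pure_extension D M f \<bottom>\<^bsub>D\<^esub> = \<bottom>\<^bsub>M\<^esub>"
    using pure_extension_eq_on_pure[OF pure.bot_closed] dba_hom_bot[OF hom] by simp
qed (simp_all add: pure_extension_closed pure_extension_join pure_extension_meet
  pure_extension_neg pure_extension_opp)

lemma pure_extension_unique:
  assumes "g \<in> dba_hom D M" "g \<in> extensional (carrier D)"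
    and "\<And>x. x \<in> carrier (dba_pure D) \<Longrightarrow> g x = f x"
  shows "g = pure_extension D M f"
proof (rule extensionalityI)
  fix x assume x: "x \<in> carrier D"
  show "g x = pure_extension D M f x"
    using D.double_boolean_algebra_axioms M.fully_contextual_dba_axioms assms(1)
      pure_extension_hom _ x
  proof (rule dba_hom_eq_if_eq_on_pure)
    show "g y = pure_extension D M f y" if "y \<in> carrier (dba_pure D)" for y
      using that by (simp only: assms(3) pure_extension_eq_on_pure)
  qed
qed (fact assms(2) pure_extension_extensional)+

end

lemma pure_extension_left_inverse:
  assumes "fully_contextual_dba D" "fully_contextual_dba M"
    and "f \<in> dba_hom (dba_pure D) (dba_pure M)" "k \<in> dba_hom (dba_pure M) (dba_pure D)"
    and inverse: "\<And>x. x \<in> carrier (dba_pure D) \<Longrightarrow> k (f x) = x"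
    and x: "x \<in> carrier D"
  shows "pure_extension M D k (pure_extension D M f x) = x"
proof -
  interpret D: fully_contextual_dba D by fact
  interpret M: fully_contextual_dba M by fact
  interpret f: dba_pure_hom D M f by unfold_locales fact
  interpret k: dba_pure_hom M D k by unfold_locales fact
  have "pure_extension M D k \<circ> pure_extension D M f \<in> dba_hom D D"
    using f.pure_extension_hom k.pure_extension_hom by (rule dba_hom_comp)
  with D.double_boolean_algebra_axioms assms(1)
  have "(pure_extension M D k \<circ> pure_extension D M f) x = id x"
    using dba_hom_id _ x
  proof (rule dba_hom_eq_if_eq_on_pure)
    fix y assume y: "y \<in> carrier (dba_pure D)"
    show "(pure_extension M D k \<circ> pure_extension D M f) y = id y"
      using k.pure_extension_eq_on_pure[OF dba_hom_closed[OF f.hom y]]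
      by (simp add: f.pure_extension_eq_on_pure[OF y] inverse[OF y])
  qed
  then show ?thesis by simp
qed

lemma pure_extension_iso:
  assumes "fully_contextual_dba D" "fully_contextual_dba M"
    and f: "f \<in> dba_iso (dba_pure D) (dba_pure M)"
  shows "pure_extension D M f \<in> dba_iso D M"
proof -
  interpret D: fully_contextual_dba D by fact
  interpret M: fully_contextual_dba M by fact
  obtain k where f_hom: "f \<in> dba_hom (dba_pure D) (dba_pure M)"
    and k_hom: "k \<in> dba_hom (dba_pure M) (dba_pure D)"
    and left: "\<And>x. x \<in> carrier (dba_pure D) \<Longrightarrow> k (f x) = x"
    and right: "\<And>y. y \<in> carrier (dba_pure M) \<Longrightarrow> f (k y) = y"
    using D.dba_pure_subalgebra f by (rule dba_isoE_inverse) blast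
  interpret f: dba_pure_hom D M f by unfold_locales (fact f_hom)
  interpret k: dba_pure_hom M D k by unfold_locales (fact k_hom)
  show ?thesis
    using f.pure_extension_hom k.pure_extension_hom
      pure_extension_left_inverse[OF assms(1,2) f_hom k_hom left]
      pure_extension_left_inverse[OF assms(2,1) k_hom f_hom right]
    by (rule dba_isoI_inverse)
qed

theorem mainTheorem13:
  fixes D :: "('a, 'm) dba_scheme" and M :: "('b, 'n) dba_scheme"
  assumes "fully_contextual_dba D" and "fully_contextual_dba M"
  shows "(dba_isomorphic D M \<longleftrightarrow> dba_isomorphic (dba_pure D) (dba_pure M)) \<and>
    (\<forall>f \<in> dba_iso (dba_pure D) (dba_pure M).
      \<exists>!g. g \<in> dba_iso D M \<and> g \<in> extensional (carrier D) \<and>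
        (\<forall>x \<in> carrier (dba_pure D). g x = f x))"
proof (intro conjI ballI)
  interpret D: fully_contextual_dba D by fact
  interpret M: fully_contextual_dba M by fact
  note D = D.double_boolean_algebra_axioms
  show "dba_isomorphic D M \<longleftrightarrow> dba_isomorphic (dba_pure D) (dba_pure M)"
    using dba_iso_pure[OF D] pure_extension_iso[OF assms] by (auto simp: dba_isomorphic_def)
  fix f assume f: "f \<in> dba_iso (dba_pure D) (dba_pure M)"
  interpret dba_pure_hom D M f by unfold_locales (use f in \<open>simp add: dba_iso_iff\<close>)
  show "\<exists>!g. g \<in> dba_iso D M \<and> g \<in> extensional (carrier D) \<and>
    (\<forall>x \<in> carrier (dba_pure D). g x = f x)"
  proof (intro ex1I[of _ "pure_extension D M f"] conjI ballI; (elim conjE)?)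
    show "pure_extension D M f \<in> dba_iso D M"
      using assms f by (rule pure_extension_iso)
    show "pure_extension D M f x = f x" if "x \<in> carrier (dba_pure D)" for x
      using that by (rule pure_extension_eq_on_pure)
    show "g = pure_extension D M f" if "g \<in> dba_iso D M" "g \<in> extensional (carrier D)"
      "\<forall>x \<in> carrier (dba_pure D). g x = f x" for g
      using that by (intro pure_extension_unique) (simp_all add: dba_iso_iff)
  qed (rule pure_extension_extensional)
qed

end
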